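(* Let $\Bbbk$ be an algebraically closed field of characteristic zero, let $n\geq 2$ be an integer, let $q\in\Bbbk$ be a primitive $n$-th root of unity, and let $f\in\Bbbk[t]$. If $n\mid j$ for every $j\in\operatorname{supp}(f)$, then $B_q(f)$ is a PI algebra.
   Context: For $q\in\Bbbk^{*}$ and $f\in\Bbbk[t]$, $B_q(f)$ is the associative unital $\Bbbk$-algebra generated by $u,v,w$ subject to the relations $uv=qvu$, $wu=quw+f(v)$, $wv=q^{-1}vw+f(u)$. For $f(t)=\sum_{j=0}^{d}c_jt^j$, the support of $f$ is $\operatorname{supp}(f)=\{\,j\mid c_j\neq 0\,\}$. An algebra $A$ is a PI algebra if its underlying ring satisfies a monic polynomial identity, i.e. there is a monic (some monomial of highest degree has coefficient $1$) polynomial $g\in\mathbb{Z}\langle x_1,\ldots,x_m\rangle$ with $g(a_1,\ldots,a_m)=0$ for all $a_1,\ldots,a_m\in A$. For an algebra over a field $\Bbbk$ this is equivalent to satisfying a nonzero polynomial identity in $\Bbbk\langle x_1,\ldots,x_m\rangle$. *)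

theory Defs
  imports
    "HOL-Algebra.QuotRing"
    "HOL-Algebra.Module"
    "HOL-Library.Poly_Mapping"
    "HOL-Computational_Algebra.Polynomial"
begin

text \<open>
  The free monoid on \<open>'x\<close>, written additively because \<^typ>\<open>'a \<Rightarrow>\<^sub>0 'b\<close> carries the convolution
  product for (not necessarily commutative) additive monoids \<open>'a\<close>.  Thus
  \<open>'x fword \<Rightarrow>\<^sub>0 'k\<close> is the free associative unital algebra \<open>k\<langle>x | x \<in> 'x\<rangle>\<close>.
\<close>

datatype 'x fword = FWord (letters: "'x list")

instantiation fword :: (type) monoid_add
begin

definition zero_fword :: "'a fword" where
  "zero_fword = FWord []"

definition plus_fword :: "'a fword \<Rightarrow> 'a fword \<Rightarrow> 'a fword" where
  "plus_fword v w = FWord (letters v @ letters w)"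

instance
  by standard (simp_all add: zero_fword_def plus_fword_def)

end

type_synonym ('x, 'k) free_alg = "'x fword \<Rightarrow>\<^sub>0 'k"

definition fconst :: "'k \<Rightarrow> ('x, 'k::comm_ring_1) free_alg" where
  "fconst c = Poly_Mapping.single 0 c"

definition fvar :: "'x \<Rightarrow> ('x, 'k::comm_ring_1) free_alg" where
  "fvar x = Poly_Mapping.single (FWord [x]) 1"

definition feval :: "'k poly \<Rightarrow> ('x, 'k) free_alg \<Rightarrow> ('x, 'k::comm_ring_1) free_alg" where
  "feval f a = (\<Sum>j\<le>degree f. fconst (coeff f j) * a ^ j)"

definition free_algebra :: "('k::comm_ring_1, ('x, 'k) free_alg) module" where
  "free_algebra = \<lparr>carrier = UNIV, monoid.mult = (*), one = 1, ring.zero = 0, add = (+),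
     module.smult = (\<lambda>c a. fconst c * a)\<rparr>"

lemma ring_free_algebra: "ring (free_algebra :: ('k::comm_ring_1, ('x, 'k) free_alg) module)"
proof -
  have "\<exists>y. x + y = 0 \<and> y + x = 0" for x :: "('x, 'k) free_alg"
    by (rule exI[of _ "- x"]) simp
  thus ?thesis
    by unfold_locales (auto simp: free_algebra_def Units_def algebra_simps)
qed

text \<open>
  The elements of \<open>rels\<close> are set to zero.  Ideals in HOL-Algebra are two-sided, and every two-sided
  ideal of the free algebra is a subspace, so the scalar multiplication descends to the quotient;
  it is spelled out in the style of \<^const>\<open>rcoset_mult\<close>.
\<close>

definition presented_algebra ::
    "('x, 'k) free_alg set \<Rightarrow> ('k::comm_ring_1, ('x, 'k) free_alg set) module" where
  "presented_algebra rels = (let F = free_algebra; I = Idl\<^bsub>F\<^esub> rels in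
     ring.extend (F Quot I)
       (module.fields (\<lambda>c X. \<Union>x\<in>X. I +>\<^bsub>F\<^esub> (c \<odot>\<^bsub>F\<^esub> x))))"

definition presented_class ::
    "('x, 'k) free_alg set \<Rightarrow> ('x, 'k::comm_ring_1) free_alg \<Rightarrow> ('x, 'k) free_alg set" where
  "presented_class rels a = (Idl\<^bsub>free_algebra\<^esub> rels) +>\<^bsub>free_algebra\<^esub> a"

datatype bgen = Gen_u | Gen_v | Gen_w

definition B_rels :: "'k::field \<Rightarrow> 'k poly \<Rightarrow> (bgen, 'k) free_alg set" where
  "B_rels q f = (let u = fvar Gen_u; v = fvar Gen_v; w = fvar Gen_w in
     {u * v - fconst q * v * u,
      w * u - (fconst q * u * w + feval f v),
      w * v - (fconst (inverse q) * v * w + feval f u)})"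

definition B_algebra :: "'k::field \<Rightarrow> 'k poly \<Rightarrow> ('k, (bgen, 'k) free_alg set) module" where
  "B_algebra q f = presented_algebra (B_rels q f)"

definition word_eval :: "('a, 'm) ring_scheme \<Rightarrow> (nat \<Rightarrow> 'a) \<Rightarrow> nat fword \<Rightarrow> 'a" where
  "word_eval R a w = foldr (\<lambda>i x. a i \<otimes>\<^bsub>R\<^esub> x) (letters w) \<one>\<^bsub>R\<^esub>"

definition nc_eval :: "('a, 'm) ring_scheme \<Rightarrow> (nat \<Rightarrow> 'a) \<Rightarrow> (nat, int) free_alg \<Rightarrow> 'a" where
  "nc_eval R a g = (\<Oplus>\<^bsub>R\<^esub>w\<in>Poly_Mapping.keys g. [Poly_Mapping.lookup g w] \<cdot>\<^bsub>R\<^esub> word_eval R a w)"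

definition nc_monic :: "(nat, int) free_alg \<Rightarrow> bool" where
  "nc_monic g \<longleftrightarrow> (\<exists>w\<in>Poly_Mapping.keys g. Poly_Mapping.lookup g w = 1 \<and>
     (\<forall>w'\<in>Poly_Mapping.keys g. length (letters w') \<le> length (letters w)))"

definition nc_vars :: "(nat, int) free_alg \<Rightarrow> nat set" where
  "nc_vars g = (\<Union>w\<in>Poly_Mapping.keys g. set (letters w))"

definition PI_ring :: "('a, 'm) ring_scheme \<Rightarrow> bool" where
  "PI_ring R \<longleftrightarrow> ring R \<and> (\<exists>m g. nc_vars g \<subseteq> {..<m} \<and> nc_monic g \<and>
     (\<forall>a. (\<forall>i<m. a i \<in> carrier R) \<longrightarrow> nc_eval R a g = \<zero>\<^bsub>R\<^esub>))"

definition primitive_root_of_unity :: "nat \<Rightarrow> 'k::field \<Rightarrow> bool" where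
  "primitive_root_of_unity n z \<longleftrightarrow> n > 0 \<and> z ^ n = 1 \<and> (\<forall>m. 0 < m \<and> m < n \<longrightarrow> z ^ m \<noteq> 1)"

definition poly_supp :: "'k::zero poly \<Rightarrow> nat set" where
  "poly_supp f = {j. coeff f j \<noteq> 0}"

lemma presented_algebra_simps:
  fixes rels :: "('x, 'k::comm_ring_1) free_alg set"
  defines "Q \<equiv> free_algebra Quot (Idl\<^bsub>free_algebra\<^esub> rels)"
  shows "carrier (presented_algebra rels) = carrier Q"
    and "monoid.mult (presented_algebra rels) = monoid.mult Q"
    and "one (presented_algebra rels) = one Q"
    and "ring.zero (presented_algebra rels) = ring.zero Q"
    and "add (presented_algebra rels) = add Q"
  by (simp_all add: presented_algebra_def Q_def Let_def ring.defs module.defs)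

lemma ideal_rels: "ideal (Idl\<^bsub>free_algebra\<^esub> rels) (free_algebra :: ('k::comm_ring_1, ('x, 'k) free_alg) module)"
  by (rule ring.genideal_ideal[OF ring_free_algebra]) (simp add: free_algebra_def)

lemma ring_presented_algebra: "ring (presented_algebra rels)"
proof -
  interpret Q: ring "free_algebra Quot (Idl\<^bsub>free_algebra\<^esub> rels)"
    by (rule ideal.quotient_is_ring[OF ideal_rels])
  note simps = presented_algebra_simps[of rels]
  show ?thesis
    by unfold_locales
      (auto simp: simps Q.a_ac Q.m_assoc Q.l_distr Q.r_distr Units_def
            intro: Q.add.l_inv_ex Q.add.r_inv_ex
            dest: Q.add.l_inv_ex Q.add.r_inv_ex)
qed

lemma ring_hom_presented_class: "presented_class rels \<in> ring_hom free_algebra (presented_algebra rels)"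
proof -
  have "(+>\<^bsub>free_algebra\<^esub>) (Idl\<^bsub>free_algebra\<^esub> rels)
          \<in> ring_hom free_algebra (free_algebra Quot (Idl\<^bsub>free_algebra\<^esub> rels))"
    by (rule ideal.rcos_ring_hom[OF ideal_rels])
  thus ?thesis
    by (simp add: ring_hom_def presented_algebra_simps presented_class_def Pi_def)
qed

lemma presented_class_eq_iff:
  "presented_class rels a = presented_class rels b \<longleftrightarrow> a - b \<in> Idl\<^bsub>free_algebra\<^esub> rels"
proof -
  interpret F: ring "free_algebra :: ('b, ('a, 'b) free_alg) module"
    by (rule ring_free_algebra)
  have inv: "\<ominus>\<^bsub>free_algebra\<^esub> x = - x" for x :: "('a, 'b) free_alg"
    by (rule F.minus_equality) (simp_all add: free_algebra_def)
  have "a \<ominus>\<^bsub>free_algebra\<^esub> b = a - b"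
    unfolding F.minus_eq inv by (simp add: free_algebra_def)
  thus ?thesis
    using ring.quotient_eq_iff_same_a_r_cos[OF ring_free_algebra ideal_rels, of a b rels]
    by (simp add: presented_class_def free_algebra_def)
qed

lemma presented_class_rel:
  assumes "a - b \<in> rels"
  shows "presented_class rels a = presented_class rels b"
proof -
  have "rels \<subseteq> Idl\<^bsub>free_algebra\<^esub> rels"
    by (rule ring.genideal_self[OF ring_free_algebra]) (simp add: free_algebra_def)
  with assms show ?thesis
    by (auto simp: presented_class_eq_iff)
qed

lemma smult_presented_class:
  fixes rels :: "('x, 'k::comm_ring_1) free_alg set"
  shows "c \<odot>\<^bsub>presented_algebra rels\<^esub> presented_class rels a = presented_class rels (fconst c * a)"
proof -
  let ?I = "Idl\<^bsub>free_algebra\<^esub> rels"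
  have I: "ideal ?I free_algebra" by (rule ideal_rels)
  have zero: "0 \<in> ?I"
    using additive_subgroup.zero_closed[OF ideal.axioms(1)[OF I]] by (simp add: free_algebra_def)
  have cls: "presented_class rels x = {i + x | i. i \<in> ?I}" for x
    by (auto simp: presented_class_def a_r_coset_def' free_algebra_def)
  have eq: "presented_class rels (fconst c * x) = presented_class rels (fconst c * a)"
    if "x \<in> presented_class rels a" for x
  proof -
    from that obtain i where i: "i \<in> ?I" "x = i + a" by (auto simp: cls)
    have "fconst c * i \<in> ?I"
      using ideal.I_l_closed[OF I i(1), of "fconst c"] by (simp add: free_algebra_def)
    thus ?thesis
      by (simp add: presented_class_eq_iff i(2) distrib_left)
  qed
  have "a \<in> presented_class rels a"
    using zero by (force simp: cls)
  hence "(\<Union>x\<in>presented_class rels a. presented_class rels (fconst c * x))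
           = presented_class rels (fconst c * a)"
    using eq by blast
  moreover have "c \<odot>\<^bsub>free_algebra\<^esub> x = fconst c * x" for x :: "('x, 'k) free_alg"
    by (simp add: free_algebra_def)
  ultimately show ?thesis
    by (simp add: presented_algebra_def Let_def ring.defs module.defs flip: presented_class_def)
qed

lemma ring_B_algebra: "ring (B_algebra q f)"
  unfolding B_algebra_def by (rule ring_presented_algebra)

end

theory Submission
  imports Defs "HOL-Combinatorics.Permutations"
begin

text \<open>
  The algebra is spanned by finitely many monomials over its centre, and such an algebra satisfies
  a standard identity.

  The source of central elements is the \<open>q\<close>-commutation formula
  \<open>y\<^sup>k x = q\<^sup>k x y\<^sup>k + (1 + q + \<dots> + q\<^sup>k\<^sup>-\<^sup>1) z y\<^sup>k\<^sup>-\<^sup>1\<close>, valid when \<open>y x = q x y + z\<close> and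
  \<open>z\<close> commutes with \<open>y\<close> (lemma \<open>power_skew_commute\<close>). For a primitive \<open>n\<close>-th root of unity \<open>q\<close> with
  \<open>n \<ge> 2\<close> the geometric sum vanishes at \<open>k = n\<close>, so that \<open>y\<^sup>n\<close> commutes with \<open>x\<close>; the same holds with
  \<open>q\<close> replaced by its inverse. The formula is applied in three rounds, whose order matters.
  With \<open>z = 0\<close> it shows that \<open>u\<^sup>n\<close> commutes with \<open>v\<close> and \<open>v\<^sup>n\<close> with \<open>u\<close>. As \<open>f\<close> is a polynomial in
  \<open>t\<^sup>n\<close>, the element \<open>f(v)\<close> then commutes with \<open>u\<close> and \<open>f(u)\<close> with \<open>v\<close>, which permits the formula for the
  pairs \<open>u, w\<close> and \<open>v, w\<close>: now \<open>u\<^sup>n\<close> and \<open>v\<^sup>n\<close> commute with \<open>w\<close> as well and are central, hence so are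
  \<open>f(u)\<close> and \<open>f(v)\<close>. Finally \<open>f(u)\<close> and \<open>f(v)\<close> commute with \<open>w\<close>, and the formula gives that \<open>w\<^sup>n\<close> is
  central.

  By the same formula the span of the monomials \<open>u\<^sup>i v\<^sup>j w\<^sup>k\<close> over the centre is closed under right
  multiplication by the generators, hence is everything; and since \<open>u\<^sup>n\<close>, \<open>v\<^sup>n\<close>, \<open>w\<^sup>n\<close> are central,
  the finitely many monomials with all exponents below \<open>n\<close> suffice (lemma \<open>in_span\<close>). The standard
  polynomial in more variables than there are spanning elements is multilinear over the centre and
  alternating, so all its values vanish (lemma \<open>std_sum_mem\<close>).

  The quotient algebra has a carrier set depending on \<open>q\<close> and \<open>f\<close> and is not a type. All
  computations therefore take place in the free algebra, which is a type of class \<open>ring_1\<close>, up to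
  congruence modulo the defining ideal, and only the values of the standard polynomial are
  transported to the quotient.
\<close>

section \<open>Commutation and spanning modulo a two-sided ideal\<close>

locale two_sided_ideal =
  fixes I :: "'a::ring_1 set"
  assumes zero_mem: "0 \<in> I"
    and add_mem: "a \<in> I \<Longrightarrow> b \<in> I \<Longrightarrow> a + b \<in> I"
    and mult_mem_left: "a \<in> I \<Longrightarrow> c * a \<in> I"
    and mult_mem_right: "a \<in> I \<Longrightarrow> a * c \<in> I"
begin

definition eqv :: "'a \<Rightarrow> 'a \<Rightarrow> bool"  (infix "\<approx>" 50)
  where "a \<approx> b \<longleftrightarrow> a - b \<in> I"

lemma uminus_mem: "a \<in> I \<Longrightarrow> - a \<in> I"
  using mult_mem_left[of a "- 1"] by simp

lemma sum_mem: "(\<And>x. x \<in> X \<Longrightarrow> g x \<in> I) \<Longrightarrow> sum g X \<in> I"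
  by (induction X rule: infinite_finite_induct) (auto intro: zero_mem add_mem)

lemma eqv_refl [simp, intro]: "a \<approx> a"
  by (simp add: eqv_def zero_mem)

lemma eqv_sym: "a \<approx> b \<Longrightarrow> b \<approx> a"
  using uminus_mem[of "a - b"] by (simp add: eqv_def)

lemma eqv_trans [trans]: "a \<approx> b \<Longrightarrow> b \<approx> c \<Longrightarrow> a \<approx> c"
  using add_mem[of "a - b" "b - c"] by (simp add: eqv_def)

lemma eqv_add: "a \<approx> b \<Longrightarrow> c \<approx> d \<Longrightarrow> a + c \<approx> b + d"
  using add_mem[of "a - b" "c - d"] by (simp add: eqv_def algebra_simps)

lemma eqv_mult: "a \<approx> b \<Longrightarrow> c \<approx> d \<Longrightarrow> a * c \<approx> b * d"
  using add_mem[OF mult_mem_right[of "a - b" c] mult_mem_left[of "c - d" b]]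
  by (simp add: eqv_def algebra_simps)

lemma mem_iff_eqv: "a \<in> I \<longleftrightarrow> a \<approx> 0"
  by (simp add: eqv_def)

text \<open>
  Commutation is only asked modulo the ideal, so that \<open>commutant T\<close> is the preimage of the
  centraliser, in the quotient, of the image of \<open>T\<close>; the case \<open>T = UNIV\<close> gives the preimage of the
  centre of the quotient.
\<close>

definition commutant :: "'a set \<Rightarrow> 'a set"
  where "commutant T = {z. \<forall>t\<in>T. z * t \<approx> t * z}"

lemma commutantD: "z \<in> commutant T \<Longrightarrow> t \<in> T \<Longrightarrow> z * t \<approx> t * z"
  by (simp add: commutant_def)

lemma commutant_0: "0 \<in> commutant T"
  by (simp add: commutant_def)

lemma commutant_1: "1 \<in> commutant T"
  by (simp add: commutant_def)

lemma commutant_add: "y \<in> commutant T \<Longrightarrow> z \<in> commutant T \<Longrightarrow> y + z \<in> commutant T"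
  by (auto simp: commutant_def distrib_left distrib_right intro!: eqv_add)

lemma commutant_mult:
  assumes "y \<in> commutant T" "z \<in> commutant T"
  shows "y * z \<in> commutant T"
  unfolding commutant_def
proof (intro CollectI ballI)
  fix t assume t: "t \<in> T"
  have "y * z * t = y * (z * t)" by (simp add: mult.assoc)
  also have "\<dots> \<approx> y * (t * z)"
    using commutantD[OF assms(2) t] by (rule eqv_mult[OF eqv_refl])
  also have "y * (t * z) = y * t * z" by (simp add: mult.assoc)
  also have "\<dots> \<approx> t * y * z"
    using commutantD[OF assms(1) t] by (rule eqv_mult[OF _ eqv_refl])
  finally show "y * z * t \<approx> t * (y * z)" by (simp add: mult.assoc)
qed

lemma commutant_power: "z \<in> commutant T \<Longrightarrow> z ^ k \<in> commutant T"
  by (induction k) (auto intro: commutant_1 commutant_mult)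

lemma commutant_sum: "(\<And>x. x \<in> X \<Longrightarrow> g x \<in> commutant T) \<Longrightarrow> sum g X \<in> commutant T"
  by (induction X rule: infinite_finite_induct) (auto intro: commutant_0 commutant_add)

lemma commutant_swap: "s \<in> commutant {t} \<longleftrightarrow> t \<in> commutant {s}"
  by (auto simp: commutant_def intro: eqv_sym)

abbreviation centre :: "'a set"
  where "centre \<equiv> commutant UNIV"

lemma centreD: "z \<in> centre \<Longrightarrow> z * a \<approx> a * z"
  by (simp add: commutantD)

text \<open>
  The scalar \<open>c\<close> commutes with everything exactly, not just modulo the ideal: it stands for a
  constant of an algebra. For \<open>k = 0\<close> the sum is empty, which makes the truncated exponent
  \<open>k - 1\<close> harmless.
\<close>

lemma power_skew_commute:
  assumes c: "\<And>a. c * a = a * c"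
    and yx: "y * x \<approx> c * x * y + z"
    and z: "z * y \<approx> y * z"
  shows "y ^ k * x \<approx> c ^ k * x * y ^ k + (\<Sum>i<k. c ^ i) * z * y ^ (k - 1)"
proof (induction k)
  case 0
  show ?case by simp
next
  case (Suc k)
  define s where "s = (\<Sum>i<k. c ^ i)"
  have c_pow: "c ^ j * a = a * c ^ j" for j a
  proof (induction j)
    case (Suc j)
    have "c ^ Suc j * a = c * (a * c ^ j)" by (simp add: mult.assoc Suc)
    also have "\<dots> = a * c ^ Suc j" unfolding mult.assoc[symmetric] c by (simp add: mult.assoc)
    finally show ?case .
  qed simp
  have c_sum: "s * a = a * s" for a
    by (simp add: s_def sum_distrib_left sum_distrib_right c_pow)
  have "y ^ Suc k * x = y * (y ^ k * x)"
    by (simp add: mult.assoc)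
  also have "\<dots> \<approx> y * (c ^ k * x * y ^ k + s * z * y ^ (k - 1))"
    using Suc.IH unfolding s_def by (rule eqv_mult[OF eqv_refl])
  also have "\<dots> = (y * c ^ k) * x * y ^ k + (y * s) * z * y ^ (k - 1)"
    by (simp add: distrib_left mult.assoc)
  also have "\<dots> = c ^ k * (y * x) * y ^ k + s * (y * z) * y ^ (k - 1)"
    unfolding c_pow[symmetric] c_sum[symmetric] by (simp add: mult.assoc)
  also have "\<dots> \<approx> c ^ k * (c * x * y + z) * y ^ k + s * (z * y) * y ^ (k - 1)"
    by (rule eqv_add; rule eqv_mult[OF _ eqv_refl]; rule eqv_mult[OF eqv_refl])
      (rule yx, rule eqv_sym[OF z])
  also have "\<dots> = c ^ Suc k * x * y ^ Suc k + (s + c ^ k) * z * y ^ k"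
  proof -
    have "y * y ^ (k - 1) = y ^ k \<or> k = 0" by (cases k) auto
    hence "s * (z * y) * y ^ (k - 1) = s * z * y ^ k"
      by (auto simp: mult.assoc s_def)
    thus ?thesis
      by (simp add: algebra_simps power_Suc2[of c] power_Suc[of y] del: power_Suc)
  qed
  finally show ?case by (simp add: s_def)
qed

lemma power_commute_of_geometric_sum_zero:
  assumes "\<And>a. c * a = a * c" and "y * x \<approx> c * x * y + z" and "z \<in> commutant {y}"
    and "c ^ n = 1" and "(\<Sum>i<n. c ^ i) = 0"
  shows "y ^ n \<in> commutant {x}"
  using power_skew_commute[OF assms(1,2), of n] assms(3-) by (simp add: commutant_def)

text \<open>
  The preimage of the span of the image of \<open>S\<close> over the centre of the quotient. The inductive form
  gives exactly the closure properties that a multilinear map has to be checked against.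
\<close>

inductive_set central_span :: "'a set \<Rightarrow> 'a set" for S where
  base: "s \<in> S \<Longrightarrow> s \<in> central_span S"
| add: "a \<in> central_span S \<Longrightarrow> b \<in> central_span S \<Longrightarrow> a + b \<in> central_span S"
| scale: "z \<in> centre \<Longrightarrow> a \<in> central_span S \<Longrightarrow> z * a \<in> central_span S"
| eqv: "a \<in> central_span S \<Longrightarrow> b \<approx> a \<Longrightarrow> b \<in> central_span S"

lemma central_span_mult_right:
  assumes "\<And>s. s \<in> S \<Longrightarrow> s * g \<in> central_span S" and "a \<in> central_span S"
  shows "a * g \<in> central_span S"
  using assms(2)
proof (induction rule: central_span.induct)
  case (base s)
  thus ?case by (rule assms(1))
next
  case (add a b)
  thus ?case by (simp add: distrib_right central_span.add)
next
  case (scale z a)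
  thus ?case by (simp add: mult.assoc central_span.scale)
next
  case (eqv a b)
  thus ?case by (blast intro: central_span.eqv eqv_mult)
qed

end

section \<open>The standard identity\<close>

text \<open>
  The value at \<open>x\<close> of the standard polynomial of degree \<open>m\<close>; the polynomial itself is \<open>std_poly\<close> below.
\<close>

definition std_sum :: "nat \<Rightarrow> (nat \<Rightarrow> 'a::ring_1) \<Rightarrow> 'a" where
  "std_sum m x = (\<Sum>p | p permutes {..<m}. of_int (sign p) * prod_list (map (x \<circ> p) [0..<m]))"

text \<open>
  Precomposition with the transposition of \<open>i\<close> and \<open>j\<close> exchanges even and odd permutations and
  preserves the products of \<open>x\<close>, so the two halves of the sum cancel. Swapping the arguments
  in the whole sum would only give that twice the sum is zero, which is weaker in characteristic 2.
\<close>

lemma std_sum_eq_0: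
  assumes ij: "i < m" "j < m" "i \<noteq> j" and eq: "x i = x j"
  shows "std_sum m x = (0 :: 'a::ring_1)"
proof -
  define P where "P p = prod_list (map (x \<circ> p) [0..<m])" for p
  define E where "E = {p. p permutes {..<m} \<and> evenperm p}"
  define O' where "O' = {p. p permutes {..<m} \<and> \<not> evenperm p}"
  define t where "t = transpose i j"
  have t: "t permutes {..<m}" using ij by (simp add: t_def permutes_swap_id)
  have t_odd: "\<not> evenperm t" using ij by (simp add: t_def evenperm_swap)
  have tt: "t \<circ> t = id" by (simp add: t_def)
  have xt: "x \<circ> t = x" using eq by (auto simp: t_def transpose_def)
  have perm: "permutation p" if "p permutes {..<m}" for p
    using that by (auto intro: permutation_permutes[THEN iffD2])
  have parity: "evenperm (t \<circ> p) \<longleftrightarrow> \<not> evenperm p" if "p permutes {..<m}" for p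
    using evenperm_comp[OF perm[OF t] perm[OF that]] t_odd by simp
  have fin: "finite {p. p permutes {..<m}}" by (simp add: finite_permutations)
  have tt': "t (t a) = a" for a using tt by (metis comp_apply id_apply)
  have EO: "sum P E = sum P O'"
  proof (rule sum.reindex_bij_witness[of _ "\<lambda>p. t \<circ> p" "\<lambda>p. t \<circ> p"])
    show "P (t \<circ> p) = P p" for p
      unfolding P_def o_assoc xt by (rule refl)
  qed (auto simp: E_def O'_def parity t permutes_compose tt' fun_eq_iff)
  have "std_sum m x = (\<Sum>p | p permutes {..<m}. of_int (sign p) * P p)"
    by (simp add: std_sum_def P_def)
  also have "{p. p permutes {..<m}} = E \<union> O'"
    by (auto simp: E_def O'_def)
  also have "(\<Sum>p\<in>E \<union> O'. of_int (sign p) * P p)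
      = (\<Sum>p\<in>E. of_int (sign p) * P p) + (\<Sum>p\<in>O'. of_int (sign p) * P p)"
    by (rule sum.union_disjoint) (auto simp: E_def O'_def intro: finite_subset[OF _ fin])
  also have "(\<Sum>p\<in>E. of_int (sign p) * P p) = sum P E"
    by (rule sum.cong) (auto simp: E_def sign_def)
  also have "(\<Sum>p\<in>O'. of_int (sign p) * P p) = - sum P O'"
    unfolding sum_negf[symmetric] by (rule sum.cong) (auto simp: O'_def sign_def)
  finally show ?thesis by (simp add: EO)
qed

text \<open>
  Each word of the standard polynomial contains the variable \<open>k\<close> once; \<open>A p\<close> and \<open>B p\<close> are the
  products to the left and to the right of it. Multilinearity in slot \<open>k\<close> can be read off from this
  form.
\<close>

lemma std_sum_slot:
  assumes "k < m"
  obtains A B :: "(nat \<Rightarrow> nat) \<Rightarrow> 'a::ring_1" where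
    "\<And>y. std_sum m (x(k := y)) = (\<Sum>p | p permutes {..<m}. of_int (sign p) * (A p * y * B p))"
proof -
  have "\<exists>A B. \<forall>y. prod_list (map (x(k := y) \<circ> p) [0..<m]) = A * y * B" if p: "p permutes {..<m}" for p
  proof -
    obtain i where i: "i < m" "p i = k"
      using p \<open>k < m\<close> permutes_image[OF p] by (metis imageE lessThan_iff)
    have other: "p j \<noteq> k" if "j \<noteq> i" for j
      using that i permutes_inj[OF p] by (metis injD)
    have "[0..<m] = [0..<i] @ i # [Suc i..<m]"
      using upt_add_eq_append[of 0 i "m - i"] i(1) by (simp add: upt_conv_Cons)
    hence "prod_list (map (x(k := y) \<circ> p) [0..<m])
        = prod_list (map (x(k := y) \<circ> p) [0..<i]) * y * prod_list (map (x(k := y) \<circ> p) [Suc i..<m])" for y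
      using i by (simp add: mult.assoc)
    moreover have "map (x(k := y) \<circ> p) [0..<i] = map (x \<circ> p) [0..<i]"
        "map (x(k := y) \<circ> p) [Suc i..<m] = map (x \<circ> p) [Suc i..<m]" for y
      using other by auto
    ultimately have "prod_list (map (x(k := y) \<circ> p) [0..<m])
        = prod_list (map (x \<circ> p) [0..<i]) * y * prod_list (map (x \<circ> p) [Suc i..<m])" for y
      by simp
    thus ?thesis by blast
  qed
  then obtain A B where "prod_list (map (x(k := y) \<circ> p) [0..<m]) = A p * y * B p"
    if "p permutes {..<m}" for p y by metis
  thus ?thesis by (intro that[of A B]) (simp add: std_sum_def)
qed

text \<open>
  By multilinearity the arguments may be replaced, one slot after the other, by elements of \<open>S\<close>;
  then the pigeonhole principle yields two equal arguments. The induction is over the number \<open>k\<close> of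
  initial slots that still hold arbitrary elements.
\<close>

lemma (in two_sided_ideal) std_sum_mem:
  assumes S: "finite S" "card S < m" and span: "\<And>a. a \<in> central_span S"
  shows "std_sum m x \<in> I"
proof -
  have "std_sum m x \<in> I" if "k \<le> m" "\<forall>i<m. k \<le> i \<longrightarrow> x i \<in> S" for k x
    using that
  proof (induction k arbitrary: x)
    case 0
    hence "x ` {..<m} \<subseteq> S" by auto
    hence "card (x ` {..<m}) < card {..<m}"
      using S card_mono[OF S(1)] by (metis card_lessThan le_less_trans)
    hence "\<not> inj_on x {..<m}" using pigeonhole by blast
    then obtain i j where "i < m" "j < m" "i \<noteq> j" "x i = x j"
      by (auto simp: inj_on_def)
    thus ?case using std_sum_eq_0[of i m j x] zero_mem by simp
  next
    case (Suc k)
    from Suc.prems have k: "k < m" by simp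
    obtain A B where AB:
      "std_sum m (x(k := y)) = (\<Sum>p | p permutes {..<m}. of_int (sign p) * (A p * y * B p))" for y
      using std_sum_slot[OF k] by metis
    have "std_sum m (x(k := y)) \<in> I" if "y \<in> central_span S" for y
      using that
    proof (induction rule: central_span.induct)
      case (base s)
      show ?case by (rule Suc.IH) (use base Suc.prems k in auto)
    next
      case (add a b)
      have "std_sum m (x(k := a + b)) = std_sum m (x(k := a)) + std_sum m (x(k := b))"
        unfolding AB by (simp add: distrib_left distrib_right sum.distrib)
      thus ?case using add_mem[OF add.IH] by metis
    next
      case (scale z a)
      \<comment> \<open>The difference consists of commutators of the central \<open>z\<close> with the left factors.\<close>
      have "std_sum m (x(k := z * a)) - z * std_sum m (x(k := a))
          = (\<Sum>p | p permutes {..<m}. of_int (sign p) * ((A p * z - z * A p) * (a * B p)))"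
      proof -
        have "z * (of_int (sign p) * (A p * a * B p)) = of_int (sign p) * (z * (A p * a * B p))" for p
          by (auto simp: sign_def)
        thus ?thesis
          unfolding AB sum_distrib_left
          by (simp add: algebra_simps flip: sum_subtractf)
      qed
      also have "\<dots> \<in> I"
        using eqv_sym[OF centreD[OF scale.hyps(1)]]
        by (intro sum_mem mult_mem_left mult_mem_right) (simp add: eqv_def)
      finally have "std_sum m (x(k := z * a)) \<approx> z * std_sum m (x(k := a))"
        by (simp add: eqv_def)
      moreover have "z * std_sum m (x(k := a)) \<approx> 0"
        using mult_mem_left[OF scale.IH, of z] unfolding mem_iff_eqv .
      ultimately show ?case using eqv_trans mem_iff_eqv by blast
    next
      case (eqv a b)
      have "std_sum m (x(k := b)) - std_sum m (x(k := a))
          = (\<Sum>p | p permutes {..<m}. of_int (sign p) * (A p * (b - a) * B p))"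
        unfolding AB by (simp add: algebra_simps flip: sum_subtractf)
      also have "\<dots> \<in> I"
        using eqv.hyps(2) by (intro sum_mem mult_mem_left mult_mem_right) (simp add: eqv_def)
      finally show ?case
        using add_mem[OF _ eqv.IH] by (metis diff_add_cancel)
    qed
    from this[OF span, of "x k"] show ?case by simp
  qed
  from this[of m x] show ?thesis by simp
qed

definition std_poly :: "nat \<Rightarrow> (nat, int) free_alg" where
  "std_poly m = (\<Sum>p | p permutes {..<m}. Poly_Mapping.single (FWord (map p [0..<m])) (sign p))"

lemma inj_on_perm_word: "inj_on (\<lambda>p. FWord (map p [0..<m])) {p. p permutes {..<m}}"
proof (rule inj_onI)
  fix p r assume "p \<in> {p. p permutes {..<m}}" "r \<in> {p. p permutes {..<m}}"
    and "FWord (map p [0..<m]) = FWord (map r [0..<m])"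
  thus "p = r"
    by (auto simp: permutes_def fun_eq_iff)
qed

lemma lookup_std_poly:
  assumes "p permutes {..<m}"
  shows "Poly_Mapping.lookup (std_poly m) (FWord (map p [0..<m])) = sign p"
proof -
  have "Poly_Mapping.lookup (std_poly m) (FWord (map p [0..<m]))
      = (\<Sum>r | r permutes {..<m}. if r = p then sign r else 0)"
    unfolding std_poly_def lookup_sum lookup_single
    using assms inj_on_eq_iff[OF inj_on_perm_word[of m]]
    by (intro sum.cong) (auto simp: when_def)
  also have "\<dots> = sign p"
    using assms by (simp add: finite_permutations)
  finally show ?thesis .
qed

lemma keys_std_poly:
  "Poly_Mapping.keys (std_poly m) = (\<lambda>p. FWord (map p [0..<m])) ` {p. p permutes {..<m}}"
proof
  have "Poly_Mapping.keys (std_poly m)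
      \<subseteq> (\<Union>p\<in>{p. p permutes {..<m}}. Poly_Mapping.keys
            (Poly_Mapping.single (FWord (map p [0..<m])) (sign p)))"
    unfolding std_poly_def by (rule keys_sum)
  thus "Poly_Mapping.keys (std_poly m) \<subseteq> (\<lambda>p. FWord (map p [0..<m])) ` {p. p permutes {..<m}}"
    by (auto split: if_splits)
  show "(\<lambda>p. FWord (map p [0..<m])) ` {p. p permutes {..<m}} \<subseteq> Poly_Mapping.keys (std_poly m)"
    by (auto simp: in_keys_iff lookup_std_poly sign_def)
qed

lemma nc_monic_std_poly: "nc_monic (std_poly m)"
  unfolding nc_monic_def
proof (intro bexI conjI)
  show "Poly_Mapping.lookup (std_poly m) (FWord (map id [0..<m])) = 1"
    using lookup_std_poly[OF permutes_id, of m] by simp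
  show "FWord (map id [0..<m]) \<in> Poly_Mapping.keys (std_poly m)"
    unfolding keys_std_poly by (intro imageI CollectI permutes_id)
qed (auto simp: keys_std_poly)

lemma nc_vars_std_poly: "nc_vars (std_poly m) \<subseteq> {..<m}"
  by (auto simp: nc_vars_def keys_std_poly permutes_in_image[where S = "{..<m}", simplified])


section \<open>Evaluation in a presented algebra\<close>

lemma free_algebra_simps [simp]:
  "carrier free_algebra = UNIV" "x \<otimes>\<^bsub>free_algebra\<^esub> y = x * y" "\<one>\<^bsub>free_algebra\<^esub> = 1"
  "\<zero>\<^bsub>free_algebra\<^esub> = 0" "x \<oplus>\<^bsub>free_algebra\<^esub> y = x + y"
  by (simp_all add: free_algebra_def)

lemma two_sided_ideal_Idl:
  "two_sided_ideal (Idl\<^bsub>free_algebra\<^esub> rels :: ('x, 'k::comm_ring_1) free_alg set)"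
proof -
  note ideal = ideal_rels[of rels]
  note subgroup = ideal.axioms(1)[OF ideal]
  show ?thesis
    using additive_subgroup.zero_closed[OF subgroup] additive_subgroup.a_closed[OF subgroup]
      ideal.I_l_closed[OF ideal] ideal.I_r_closed[OF ideal]
    by unfold_locales auto
qed

context
  fixes rels :: "('x, 'k::comm_ring_1) free_alg set"
begin

interpretation R: ring "presented_algebra rels"
  by (rule ring_presented_algebra)

lemma presented_class_closed: "presented_class rels x \<in> carrier (presented_algebra rels)"
  using ring_hom_closed[OF ring_hom_presented_class, of x] by simp

lemma presented_class_add:
  "presented_class rels (x + y)
     = presented_class rels x \<oplus>\<^bsub>presented_algebra rels\<^esub> presented_class rels y"
  using ring_hom_add[OF ring_hom_presented_class, of x y] by simp

lemma presented_class_mult: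
  "presented_class rels (x * y)
     = presented_class rels x \<otimes>\<^bsub>presented_algebra rels\<^esub> presented_class rels y"
  using ring_hom_mult[OF ring_hom_presented_class, of x y] by simp

lemma presented_class_one: "presented_class rels 1 = \<one>\<^bsub>presented_algebra rels\<^esub>"
  using ring_hom_one[OF ring_hom_presented_class] by simp

lemma presented_class_zero: "presented_class rels 0 = \<zero>\<^bsub>presented_algebra rels\<^esub>"
  using ring_hom_zero[OF ring_hom_presented_class ring_free_algebra R.ring_axioms] by simp

lemma presented_class_uminus:
  "presented_class rels (- x) = \<ominus>\<^bsub>presented_algebra rels\<^esub> presented_class rels x"
  by (rule R.minus_equality[symmetric])
    (simp_all add: presented_class_closed presented_class_zero flip: presented_class_add)

lemma presented_class_of_nat_mult:
  "[k] \<cdot>\<^bsub>presented_algebra rels\<^esub> presented_class rels x = presented_class rels (of_nat k * x)"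
  for k :: nat
  by (induction k)
    (simp_all add: presented_class_zero presented_class_closed distrib_right add.commute
      flip: presented_class_add)

lemma presented_class_of_int_mult:
  "[k] \<cdot>\<^bsub>presented_algebra rels\<^esub> presented_class rels x = presented_class rels (of_int k * x)"
  for k :: int
  by (cases "k \<ge> 0")
    (simp_all add: add_pow_int_ge add_pow_int_lt presented_class_of_nat_mult
      flip: presented_class_uminus)

lemma presented_class_sum:
  "finite X \<Longrightarrow> (\<Oplus>\<^bsub>presented_algebra rels\<^esub>i\<in>X. presented_class rels (h i))
     = presented_class rels (sum h X)"
  by (induction X rule: finite_induct)
    (simp_all add: presented_class_zero presented_class_add presented_class_closed Pi_def)

lemma presented_class_surj:
  assumes "X \<in> carrier (presented_algebra rels)"
  obtains x where "X = presented_class rels x"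
  using assms
  by (auto simp: presented_algebra_simps FactRing_def A_RCOSETS_def' presented_class_def)

text \<open>
  As the class map is a ring homomorphism, the standard polynomial can be evaluated on
  representatives \<open>x i\<close> in the free algebra.
\<close>

lemma nc_eval_std_poly:
  assumes x: "\<And>i. i < m \<Longrightarrow> a i = presented_class rels (x i)"
  shows "nc_eval (presented_algebra rels) a (std_poly m) = presented_class rels (std_sum m x)"
proof -
  let ?R = "presented_algebra rels"
  define word where "word p = FWord (map p [0..<m])" for p :: "nat \<Rightarrow> nat"
  have foldr: "foldr (\<lambda>i y. a i \<otimes>\<^bsub>?R\<^esub> y) ks \<one>\<^bsub>?R\<^esub> = presented_class rels (prod_list (map x ks))"
    if "set ks \<subseteq> {..<m}" for ks
    using that by (induction ks) (auto simp: presented_class_one presented_class_mult x)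
  have summand: "[Poly_Mapping.lookup (std_poly m) w] \<cdot>\<^bsub>?R\<^esub> word_eval ?R a w
      = presented_class rels (of_int (Poly_Mapping.lookup (std_poly m) w) * prod_list (map x (letters w)))"
    if "w \<in> Poly_Mapping.keys (std_poly m)" for w
  proof -
    have "set (letters w) \<subseteq> {..<m}"
      using nc_vars_std_poly[of m] that by (auto simp: nc_vars_def)
    thus ?thesis by (simp add: word_eval_def foldr presented_class_of_int_mult)
  qed
  have "nc_eval ?R a (std_poly m)
      = (\<Oplus>\<^bsub>?R\<^esub>w\<in>Poly_Mapping.keys (std_poly m). presented_class rels
          (of_int (Poly_Mapping.lookup (std_poly m) w) * prod_list (map x (letters w))))"
    unfolding nc_eval_def
    by (rule R.finsum_cong') (auto simp: summand presented_class_closed)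
  also have "\<dots> = presented_class rels (\<Sum>w\<in>Poly_Mapping.keys (std_poly m).
      of_int (Poly_Mapping.lookup (std_poly m) w) * prod_list (map x (letters w)))"
    by (rule presented_class_sum) simp
  also have "(\<Sum>w\<in>Poly_Mapping.keys (std_poly m).
      of_int (Poly_Mapping.lookup (std_poly m) w) * prod_list (map x (letters w))) = std_sum m x"
    unfolding keys_std_poly std_sum_def
    by (subst sum.reindex[OF inj_on_perm_word]) (auto intro!: sum.cong simp: lookup_std_poly)
  finally show ?thesis .
qed

lemma PI_ring_presented_algebraI:
  assumes "\<And>x. std_sum m x \<in> Idl\<^bsub>free_algebra\<^esub> rels"
  shows "PI_ring (presented_algebra rels)"
  unfolding PI_ring_def
proof (intro conjI exI allI impI)
  show "ring (presented_algebra rels)" by (rule ring_presented_algebra)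
  show "nc_vars (std_poly m) \<subseteq> {..<m}" by (rule nc_vars_std_poly)
  show "nc_monic (std_poly m)" by (rule nc_monic_std_poly)
  fix a assume "\<forall>i<m. a i \<in> carrier (presented_algebra rels)"
  hence "\<forall>i\<in>{..<m}. \<exists>y. a i = presented_class rels y"
    using presented_class_surj by (metis lessThan_iff)
  then obtain x where "\<forall>i\<in>{..<m}. a i = presented_class rels (x i)"
    by (rule bchoice[THEN exE])
  hence "a i = presented_class rels (x i)" if "i < m" for i
    using that by simp
  hence "nc_eval (presented_algebra rels) a (std_poly m) = presented_class rels (std_sum m x)"
    by (rule nc_eval_std_poly)
  also have "\<dots> = presented_class rels 0"
    using assms by (simp add: presented_class_eq_iff)
  finally show "nc_eval (presented_algebra rels) a (std_poly m) = \<zero>\<^bsub>presented_algebra rels\<^esub>"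
    by (simp add: presented_class_zero)
qed

end

section \<open>Scalars and generators of the free algebra\<close>

lemma fconst_add: "fconst (a + b) = fconst a + fconst b"
  by (simp add: fconst_def single_add)

lemma fconst_mult: "fconst (a * b) = fconst a * fconst b"
  by (simp add: fconst_def mult_single)

lemma fconst_0 [simp]: "fconst 0 = 0"
  by (simp add: fconst_def)

lemma fconst_1 [simp]: "fconst 1 = 1"
  by (simp add: fconst_def)

lemma fconst_power: "fconst (a ^ k) = fconst a ^ k"
  by (induction k) (simp_all add: fconst_mult)

lemma fconst_sum: "fconst (sum h X) = (\<Sum>x\<in>X. fconst (h x))"
  by (induction X rule: infinite_finite_induct) (simp_all add: fconst_add)

lemma single_word_eq:
  fixes w :: "'x fword" and c :: "'k::comm_ring_1"
  shows "Poly_Mapping.single w c = fconst c * prod_list (map fvar (letters w))"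
proof -
  have "Poly_Mapping.single (FWord xs) 1 = prod_list (map fvar xs :: ('x, 'k) free_alg list)" for xs
  proof (induction xs)
    case Nil
    show ?case by (simp flip: zero_fword_def)
  next
    case (Cons x xs)
    have "FWord (x # xs) = FWord [x] + FWord xs" by (simp add: plus_fword_def)
    hence "Poly_Mapping.single (FWord (x # xs)) 1
        = (fvar x * Poly_Mapping.single (FWord xs) 1 :: ('x, 'k) free_alg)"
      by (simp add: fvar_def mult_single)
    thus ?case by (simp add: Cons)
  qed
  moreover have "Poly_Mapping.single w c = fconst c * Poly_Mapping.single (FWord (letters w)) 1"
    by (simp add: fconst_def mult_single)
  ultimately show ?thesis by (simp del: fword.collapse)
qed

lemma sum_single_lookup:
  "(\<Sum>w\<in>Poly_Mapping.keys a. Poly_Mapping.single w (Poly_Mapping.lookup a w)) = a"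
  by (rule poly_mapping_eqI)
    (simp add: lookup_sum lookup_single when_def in_keys_iff)

lemma free_alg_induct [case_names const var add mult]:
  assumes const: "\<And>c. P (fconst c)" and var: "\<And>x. P (fvar x)"
    and add: "\<And>a b. P a \<Longrightarrow> P b \<Longrightarrow> P (a + b)"
    and mult: "\<And>a b. P a \<Longrightarrow> P b \<Longrightarrow> P (a * b)"
  shows "P (a :: ('x, 'k::comm_ring_1) free_alg)"
proof -
  have "P (prod_list (map fvar xs))" for xs
    using const[of 1] by (induction xs) (auto intro: var mult)
  hence single: "P (Poly_Mapping.single w c)" for w c
    by (simp add: single_word_eq const mult)
  have "P (\<Sum>w\<in>X. Poly_Mapping.single w (Poly_Mapping.lookup a w))" for X
    using const[of 0] by (induction X rule: infinite_finite_induct) (auto intro: add single)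
  from this[of "Poly_Mapping.keys a"] show ?thesis by (simp add: sum_single_lookup)
qed

lemma fconst_commute: "fconst c * a = a * fconst c"
proof -
  have s: "fconst c * Poly_Mapping.single w d = Poly_Mapping.single w d * fconst c" for w d
    by (simp add: fconst_def mult_single mult.commute)
  have "fconst c * (\<Sum>w\<in>X. Poly_Mapping.single w (Poly_Mapping.lookup a w))
      = (\<Sum>w\<in>X. Poly_Mapping.single w (Poly_Mapping.lookup a w)) * fconst c" for X
    by (simp add: sum_distrib_left sum_distrib_right s)
  from this[of "Poly_Mapping.keys a"] show ?thesis by (simp add: sum_single_lookup)
qed


section \<open>The algebra \<open>B_q(f)\<close> at a root of unity\<close>

lemma primitive_root_geometric_sum:
  assumes "n \<ge> 2" "primitive_root_of_unity n q"
  shows "(\<Sum>i<n. q ^ i) = 0"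
proof -
  have "q ^ n = 1" "q \<noteq> 1"
    using assms power_one_right[of q] by (auto simp: primitive_root_of_unity_def)
  thus ?thesis by (simp add: geometric_sum)
qed

locale B_at_root_of_unity =
  fixes n :: nat and q :: "'k::field" and f :: "'k poly"
  assumes n_ge_2: "n \<ge> 2"
    and q_root: "primitive_root_of_unity n q"
    and supp_dvd: "\<And>j. j \<in> poly_supp f \<Longrightarrow> n dvd j"
begin

sublocale two_sided_ideal "Idl\<^bsub>free_algebra\<^esub> (B_rels q f)"
  by (rule two_sided_ideal_Idl)

notation eqv  (infix "\<approx>" 50)

abbreviation u :: "(bgen, 'k) free_alg" where "u \<equiv> fvar Gen_u"
abbreviation v :: "(bgen, 'k) free_alg" where "v \<equiv> fvar Gen_v"
abbreviation w :: "(bgen, 'k) free_alg" where "w \<equiv> fvar Gen_w"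

lemma q_nonzero: "q \<noteq> 0"
  using q_root n_ge_2 by (auto simp: primitive_root_of_unity_def zero_power)

lemma fconst_q_inverse: "fconst q * fconst (inverse q) = 1" "fconst (inverse q) * fconst q = 1"
  using q_nonzero by (simp_all flip: fconst_mult)

lemma
  shows fconst_q_power: "fconst q ^ n = 1"
    and fconst_q_geometric: "(\<Sum>i<n. fconst q ^ i) = 0"
  using q_root primitive_root_geometric_sum[OF n_ge_2 q_root]
  by (simp_all add: primitive_root_of_unity_def flip: fconst_power fconst_sum)

lemma inverse_q_root: "primitive_root_of_unity n (inverse q)"
  using q_root by (simp add: primitive_root_of_unity_def power_inverse)

lemma
  shows fconst_inverse_q_power: "fconst (inverse q) ^ n = 1"
    and fconst_inverse_q_geometric: "(\<Sum>i<n. fconst (inverse q) ^ i) = 0"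
  using inverse_q_root primitive_root_geometric_sum[OF n_ge_2 inverse_q_root]
  by (simp_all only: primitive_root_of_unity_def fconst_1 fconst_0 flip: fconst_power fconst_sum)

lemma rel_eqv:
  assumes "a - b \<in> B_rels q f"
  shows "a \<approx> b"
  using presented_class_rel[OF assms] by (simp add: eqv_def presented_class_eq_iff)

lemma uv: "u * v \<approx> fconst q * v * u"
  by (rule rel_eqv) (simp add: B_rels_def Let_def)

lemma wu: "w * u \<approx> fconst q * u * w + feval f v"
  by (rule rel_eqv) (simp add: B_rels_def Let_def)

lemma wv: "w * v \<approx> fconst (inverse q) * v * w + feval f u"
  by (rule rel_eqv) (simp add: B_rels_def Let_def)

text \<open>
  Reading a skew commutation relation from right to left inverts the scalar. This is how
  \<open>power_skew_commute\<close> yields statements about powers of \<open>u\<close> and \<open>v\<close> from the relations for \<open>w u\<close> and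
  \<open>w v\<close>.
\<close>

lemma skew_swap:
  assumes "y * x \<approx> fconst c * x * y + z" and "fconst d * fconst c = (1 :: (bgen, 'k) free_alg)"
  shows "x * y \<approx> fconst d * y * x + - (fconst d * z)"
proof -
  have "fconst d * (y * x) + - (fconst d * z) \<approx> fconst d * (fconst c * x * y + z) + - (fconst d * z)"
    by (intro eqv_add eqv_mult eqv_refl assms(1))
  also have "\<dots> = (fconst d * fconst c) * x * y"
    by (simp add: algebra_simps)
  also have "\<dots> = x * y"
    using assms(2) by simp
  finally show ?thesis
    unfolding mult.assoc by (rule eqv_sym)
qed

lemma fconst_in_commutant: "fconst c \<in> commutant T"
  by (simp add: commutant_def fconst_commute[of c])

text \<open>
  The commutant of \<open>z\<close> is a subalgebra, so it is everything once it contains the generators.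
\<close>

lemma in_centreI:
  assumes "z \<in> commutant {u}" "z \<in> commutant {v}" "z \<in> commutant {w}"
  shows "z \<in> centre"
proof -
  have "a \<in> commutant {z}" for a
  proof (induction a rule: free_alg_induct)
    case (var x)
    thus ?case using assms by (cases x) (simp_all add: commutant_swap[of _ z])
  qed (auto intro: fconst_in_commutant commutant_add commutant_mult)
  hence "z \<in> commutant {a}" for a
    by (simp add: commutant_swap[of z])
  thus ?thesis by (simp add: commutant_def)
qed

text \<open>
  The only place where the hypothesis on the support enters: \<open>f(a)\<close> is a polynomial in \<open>a\<^sup>n\<close>.
\<close>

lemma feval_in_commutant:
  assumes "a ^ n \<in> commutant T"
  shows "feval f a \<in> commutant T"
  unfolding feval_def
proof (rule commutant_sum)
  fix j
  show "fconst (coeff f j) * a ^ j \<in> commutant T"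
  proof (cases "coeff f j = 0")
    case False
    then obtain k where "j = n * k"
      using supp_dvd[of j] by (auto simp: poly_supp_def)
    thus ?thesis
      using assms by (auto simp: power_mult intro!: commutant_mult fconst_in_commutant commutant_power)
  qed (simp add: commutant_0)
qed

lemma power_n_self_commute: "a ^ n \<in> commutant {a}"
  by (simp add: commutant_def power_commutes)

lemma vu: "v * u \<approx> fconst (inverse q) * u * v"
  using skew_swap[of u v q 0, OF _ fconst_q_inverse(2)] uv by simp

lemma u_power_n_v: "u ^ n \<in> commutant {v}"
  by (rule power_commute_of_geometric_sum_zero[OF fconst_commute _ commutant_0
        fconst_q_power fconst_q_geometric]) (use uv in simp)

lemma v_power_n_u: "v ^ n \<in> commutant {u}"
  by (rule power_commute_of_geometric_sum_zero[OF fconst_commute _ commutant_0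
        fconst_inverse_q_power fconst_inverse_q_geometric]) (use vu in simp)

lemma uminus_fconst_mult_in_commutant:
  assumes "z \<in> commutant T"
  shows "- (fconst c * z) \<in> commutant T"
  using commutant_mult[OF fconst_in_commutant[of "- 1"] commutant_mult[OF fconst_in_commutant assms, of c]]
  by (simp add: fconst_def single_uminus)

text \<open>
  For the commutation with \<open>w\<close>, the inhomogeneous term of the relation for \<open>u w\<close> is a multiple of
  \<open>f(v)\<close>, which commutes with \<open>u\<close> because \<open>v\<^sup>n\<close> does. The argument for \<open>v\<^sup>n\<close> is symmetric.
\<close>

lemma u_power_n_central: "u ^ n \<in> centre"
proof (rule in_centreI[OF power_n_self_commute u_power_n_v])
  show "u ^ n \<in> commutant {w}"
    by (rule power_commute_of_geometric_sum_zero[OF fconst_commute skew_swap[OF wu fconst_q_inverse(2)]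
          uminus_fconst_mult_in_commutant fconst_inverse_q_power fconst_inverse_q_geometric])
      (rule feval_in_commutant[OF v_power_n_u])
qed

lemma v_power_n_central: "v ^ n \<in> centre"
proof (rule in_centreI[OF v_power_n_u power_n_self_commute])
  show "v ^ n \<in> commutant {w}"
    by (rule power_commute_of_geometric_sum_zero[OF fconst_commute skew_swap[OF wv fconst_q_inverse(1)]
          uminus_fconst_mult_in_commutant fconst_q_power fconst_q_geometric])
      (rule feval_in_commutant[OF u_power_n_v])
qed

lemma feval_u_central: "feval f u \<in> centre"
  and feval_v_central: "feval f v \<in> centre"
  by (rule feval_in_commutant u_power_n_central v_power_n_central)+

lemma centre_commutant: "z \<in> centre \<Longrightarrow> z \<in> commutant T"
  by (simp add: commutant_def)

lemma w_power_n_central: "w ^ n \<in> centre"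
proof (rule in_centreI[OF _ _ power_n_self_commute])
  show "w ^ n \<in> commutant {u}"
    by (rule power_commute_of_geometric_sum_zero[OF fconst_commute wu
          centre_commutant[OF feval_v_central] fconst_q_power fconst_q_geometric])
  show "w ^ n \<in> commutant {v}"
    by (rule power_commute_of_geometric_sum_zero[OF fconst_commute wv
          centre_commutant[OF feval_u_central] fconst_inverse_q_power fconst_inverse_q_geometric])
qed

definition mon :: "nat \<Rightarrow> nat \<Rightarrow> nat \<Rightarrow> (bgen, 'k) free_alg" where
  "mon i j k = u ^ i * v ^ j * w ^ k"

definition reduced_mons :: "(bgen, 'k) free_alg set" where
  "reduced_mons = (\<lambda>(i, j, k). mon i j k) ` ({..<n} \<times> {..<n} \<times> {..<n})"

lemma finite_reduced_mons: "finite reduced_mons"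
  by (simp add: reduced_mons_def)

lemma centre_left_commute: "z \<in> centre \<Longrightarrow> a * (z * b) \<approx> z * (a * b)"
  using eqv_mult[OF eqv_sym[OF centreD[of z a]] eqv_refl[of b]] by (simp add: mult.assoc)

text \<open>
  The central factors \<open>u\<^sup>n\<close>, \<open>v\<^sup>n\<close>, \<open>w\<^sup>n\<close> are split off and moved to the front, which leaves the
  remainders of the exponents.
\<close>

lemma mon_in_span: "mon i j k \<in> central_span reduced_mons"
proof -
  define p where "p = u ^ (i mod n)"
  define r where "r = v ^ (j mod n)"
  define s where "s = w ^ (k mod n)"
  define a where "a = (u ^ n) ^ (i div n)"
  define b where "b = (v ^ n) ^ (j div n)"
  define c where "c = (w ^ n) ^ (k div n)"
  have n: "n > 0" using n_ge_2 by simp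
  have split: "x ^ l = (x ^ n) ^ (l div n) * x ^ (l mod n)" for x :: "(bgen, 'k) free_alg" and l
    by (simp flip: power_mult power_add)
  have cent: "a \<in> centre" "b \<in> centre" "c \<in> centre"
    unfolding a_def b_def c_def
    by (intro commutant_power u_power_n_central v_power_n_central w_power_n_central)+
  have "mon i j k = a * (p * (b * (r * (c * s))))"
    unfolding mon_def split[of u i] split[of v j] split[of w k]
    by (simp add: p_def r_def s_def a_def b_def c_def mult.assoc)
  also have "\<dots> \<approx> a * (b * (p * (r * (c * s))))"
    by (intro eqv_mult[OF eqv_refl] centre_left_commute cent)
  also have "\<dots> \<approx> a * (b * (p * (c * (r * s))))"
    by (intro eqv_mult[OF eqv_refl] centre_left_commute cent)
  also have "\<dots> \<approx> a * (b * (c * (p * (r * s))))"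
    by (intro eqv_mult[OF eqv_refl] centre_left_commute cent)
  also have "p * (r * s) = mon (i mod n) (j mod n) (k mod n)"
    by (simp add: mon_def p_def r_def s_def mult.assoc)
  finally have "mon i j k \<approx> a * (b * (c * mon (i mod n) (j mod n) (k mod n)))" .
  moreover have "mon (i mod n) (j mod n) (k mod n) \<in> reduced_mons"
    unfolding reduced_mons_def
    by (rule image_eqI[of _ _ "(i mod n, j mod n, k mod n)"]) (use n in auto)
  ultimately show ?thesis
    using cent by (meson central_span.base central_span.scale central_span.eqv)
qed

text \<open>
  In the order \<open>u, v, w\<close> of the factors, a generator multiplied from the right has to be moved to the
  left past powers of the later generators. This scales the monomial, and passing \<open>w\<^sup>k\<close> adds a
  central multiple of a monomial of lower degree in \<open>w\<close>.
\<close>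

lemma mon_times_w: "mon i j k * w \<in> central_span reduced_mons"
proof -
  have "mon i j k * w = mon i j (Suc k)"
    by (simp add: mon_def mult.assoc power_commutes)
  thus ?thesis by (simp add: mon_in_span)
qed

lemma fconst_sum_power_central: "(\<Sum>l\<in>X. fconst c ^ l) \<in> centre"
  by (intro commutant_sum commutant_power fconst_in_commutant)

lemma mon_times_v: "mon i j k * v \<in> central_span reduced_mons"
proof -
  define c :: "(bgen, 'k) free_alg" where "c = fconst (inverse q) ^ k"
  define z where "z = (\<Sum>l<k. fconst (inverse q) ^ l) * feval f u"
  have c: "c \<in> centre" unfolding c_def by (intro commutant_power fconst_in_commutant)
  have z: "z \<in> centre"
    unfolding z_def by (intro commutant_mult fconst_sum_power_central feval_u_central)
  have "mon i j k * v = u ^ i * v ^ j * (w ^ k * v)"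
    by (simp add: mon_def mult.assoc)
  also have "\<dots> \<approx> u ^ i * v ^ j * (c * v * w ^ k + z * w ^ (k - 1))"
    unfolding c_def z_def
    by (intro eqv_mult[OF eqv_refl] power_skew_commute[OF fconst_commute wv] centreD feval_u_central)
  also have "\<dots> = u ^ i * v ^ j * (c * (v * w ^ k)) + u ^ i * v ^ j * (z * w ^ (k - 1))"
    by (simp add: distrib_left mult.assoc)
  also have "\<dots> \<approx> c * (u ^ i * v ^ j * (v * w ^ k)) + z * (u ^ i * v ^ j * w ^ (k - 1))"
    by (intro eqv_add centre_left_commute c z)
  also have "\<dots> = c * mon i (Suc j) k + z * mon i j (k - 1)"
    by (simp add: mon_def mult.assoc power_Suc2[of v] del: power_Suc)
  finally show ?thesis
    by (rule central_span.eqv[rotated]) (intro central_span.add central_span.scale c z mon_in_span)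
qed

lemma mon_times_u: "mon i j k * u \<in> central_span reduced_mons"
proof -
  define c :: "(bgen, 'k) free_alg" where "c = fconst q ^ k"
  define d :: "(bgen, 'k) free_alg" where "d = fconst (inverse q) ^ j"
  define z where "z = (\<Sum>l<k. fconst q ^ l) * feval f v"
  have c: "c \<in> centre" unfolding c_def by (intro commutant_power fconst_in_commutant)
  have d: "d \<in> centre" unfolding d_def by (intro commutant_power fconst_in_commutant)
  have z: "z \<in> centre"
    unfolding z_def by (intro commutant_mult fconst_sum_power_central feval_v_central)
  have vu_pow: "v ^ j * u \<approx> d * u * v ^ j"
    using power_skew_commute[where c = "fconst (inverse q)" and y = v and x = u and z = 0 and k = j,
        OF fconst_commute] vu
    by (simp add: d_def)
  have "mon i j k * u = u ^ i * v ^ j * (w ^ k * u)"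
    by (simp add: mon_def mult.assoc)
  also have "\<dots> \<approx> u ^ i * v ^ j * (c * u * w ^ k + z * w ^ (k - 1))"
    unfolding c_def z_def
    by (intro eqv_mult[OF eqv_refl] power_skew_commute[OF fconst_commute wu] centreD feval_v_central)
  also have "\<dots> = u ^ i * v ^ j * (c * (u * w ^ k)) + u ^ i * v ^ j * (z * w ^ (k - 1))"
    by (simp add: distrib_left mult.assoc)
  also have "\<dots> \<approx> c * (u ^ i * v ^ j * (u * w ^ k)) + z * (u ^ i * v ^ j * w ^ (k - 1))"
    by (intro eqv_add centre_left_commute c z)
  also have "\<dots> = c * (u ^ i * ((v ^ j * u) * w ^ k)) + z * mon i j (k - 1)"
    by (simp add: mon_def mult.assoc)
  also have "\<dots> \<approx> c * (u ^ i * ((d * u * v ^ j) * w ^ k)) + z * mon i j (k - 1)"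
    by (intro eqv_add eqv_mult eqv_refl vu_pow)
  also have "\<dots> = c * (u ^ i * (d * (u * v ^ j * w ^ k))) + z * mon i j (k - 1)"
    by (simp add: mult.assoc)
  also have "\<dots> \<approx> c * (d * (u ^ i * (u * v ^ j * w ^ k))) + z * mon i j (k - 1)"
    by (intro eqv_add eqv_mult[OF eqv_refl] eqv_refl centre_left_commute d)
  also have "\<dots> = c * (d * mon (Suc i) j k) + z * mon i j (k - 1)"
    by (simp add: mon_def mult.assoc power_Suc2[of u] del: power_Suc)
  finally show ?thesis
    by (rule central_span.eqv[rotated]) (intro central_span.add central_span.scale c d z mon_in_span)
qed

text \<open>
  The elements that map the span into itself by right multiplication form a subalgebra containing
  the generators, hence are all of the free algebra; and the span contains \<open>1\<close>.
\<close>

lemma in_span: "a \<in> central_span reduced_mons"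
proof -
  have "x * a \<in> central_span reduced_mons" if "x \<in> central_span reduced_mons" for x
    using that
  proof (induction a arbitrary: x rule: free_alg_induct)
    case (const c)
    thus ?case
      using fconst_in_commutant by (simp add: central_span.scale flip: fconst_commute)
  next
    case (var g)
    have "s * fvar g \<in> central_span reduced_mons" if s: "s \<in> reduced_mons" for s
    proof -
      obtain i j k where "s = mon i j k" using s by (auto simp: reduced_mons_def)
      thus ?thesis by (cases g) (simp_all add: mon_times_u mon_times_v mon_times_w)
    qed
    thus ?case using var by (rule central_span_mult_right)
  next
    case (add a b)
    thus ?case by (simp add: distrib_left central_span.add)
  next
    case (mult a b)
    thus ?case by (simp flip: mult.assoc)
  qed
  from this[of 1] mon_in_span[of 0 0 0] show ?thesis by (simp add: mon_def)
qed

lemma PI_ring_B_algebra: "PI_ring (B_algebra q f)"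
  unfolding B_algebra_def
  by (rule PI_ring_presented_algebraI)
    (rule std_sum_mem[OF finite_reduced_mons lessI in_span])

end

theorem proposition9p9:
  fixes n :: nat and q :: "'k::{alg_closed_field, field_char_0}" and f :: "'k poly"
  assumes "n \<ge> 2"
    and "primitive_root_of_unity n q"
    and "\<forall>j\<in>poly_supp f. n dvd j"
  shows "PI_ring (B_algebra q f)"
proof -
  interpret B_at_root_of_unity n q f
    using assms by unfold_locales auto
  show ?thesis by (rule PI_ring_B_algebra)
qed

end
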